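(* Let $f:2^E\to\mathbb{R}_+$ be a nontrivial monotone submodular function with $f(\emptyset)=0$, and let $\emptyset=\Pi_0\subsetneq\Pi_1\subsetneq\cdots\subsetneq\Pi_s=E$ be its principal partition. Let $\kappa_f=\max_{x\in E}f(\{x\})$ and $\ell_f=f(E)/\kappa_f$. Let $\sigma:E\to\{1,\dots,|E|\}$ be any bijection that is a linear extension of the principal partition, i.e., $E_{|\Pi_i|,\sigma}=\Pi_i$ for all $1\le i\le s$. Then $\sum_{i=1}^{|E|}f(E_{i,\sigma})$ is at most $2-\frac{1+\ell_f}{1+|E|}$ times $\min_{\pi}\sum_{i=1}^{|E|}f(E_{i,\pi})$, the minimum over all bijections $\pi:E\to\{1,\dots,|E|\}$.
   Context: $E_{i,\sigma}=\{e\in E:\sigma(e)\le i\}$. Nontrivial means $f(E)\ne 0$. The principal partition of $f$ consists of an integer $s\ge1$, nested sets $\emptyset=\Pi_0\subsetneq\cdots\subsetneq\Pi_s=E$ and reals (critical values) $\lambda_0<\lambda_1<\cdots<\lambda_{s+1}$ such that for every $0\le i\le s$ and every $\lambda\in(\lambda_i,\lambda_{i+1})$, $\Pi_i$ is the unique maximal minimizer of $X\mapsto f(X)-\lambda|X|$ over $X\subseteq E$. *)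

theory Defs
  imports Complex_Main
begin

definition submodular_on :: "'a set \<Rightarrow> ('a set \<Rightarrow> real) \<Rightarrow> bool" where
  "submodular_on E f \<longleftrightarrow>
    (\<forall>A B. A \<subseteq> E \<longrightarrow> B \<subseteq> E \<longrightarrow> f (A \<union> B) + f (A \<inter> B) \<le> f A + f B)"

definition minimizer :: "'a set \<Rightarrow> ('a set \<Rightarrow> real) \<Rightarrow> real \<Rightarrow> 'a set \<Rightarrow> bool" where
  "minimizer E f l X \<longleftrightarrow> is_arg_min (\<lambda>Y. f Y - l * real (card Y)) (\<lambda>Y. Y \<subseteq> E) X"

definition maximal_minimizer :: "'a set \<Rightarrow> ('a set \<Rightarrow> real) \<Rightarrow> real \<Rightarrow> 'a set \<Rightarrow> bool" where
  "maximal_minimizer E f l X \<longleftrightarrow>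
    minimizer E f l X \<and> (\<forall>Y. minimizer E f l Y \<longrightarrow> X \<subseteq> Y \<longrightarrow> Y = X)"

definition unique_maximal_minimizer :: "'a set \<Rightarrow> ('a set \<Rightarrow> real) \<Rightarrow> real \<Rightarrow> 'a set \<Rightarrow> bool" where
  "unique_maximal_minimizer E f l X \<longleftrightarrow>
    maximal_minimizer E f l X \<and> (\<forall>Y. maximal_minimizer E f l Y \<longrightarrow> Y = X)"

text \<open>Only the values \<open>P 0, \<dots>, P s\<close> and \<open>lam 0, \<dots>, lam (s + 1)\<close> are constrained.\<close>

definition principal_partition ::
  "'a set \<Rightarrow> ('a set \<Rightarrow> real) \<Rightarrow> nat \<Rightarrow> (nat \<Rightarrow> 'a set) \<Rightarrow> (nat \<Rightarrow> real) \<Rightarrow> bool" where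
  "principal_partition E f s P lam \<longleftrightarrow>
    1 \<le> s \<and> P 0 = {} \<and> P s = E \<and>
    (\<forall>i<s. P i \<subset> P (i + 1)) \<and>
    (\<forall>i\<le>s. lam i < lam (i + 1)) \<and>
    (\<forall>i\<le>s. \<forall>l. lam i < l \<and> l < lam (i + 1) \<longrightarrow> unique_maximal_minimizer E f l (P i))"

definition prefix_set :: "'a set \<Rightarrow> ('a \<Rightarrow> nat) \<Rightarrow> nat \<Rightarrow> 'a set" where
  "prefix_set E \<sigma> i = {e \<in> E. \<sigma> e \<le> i}"

definition orderings :: "'a set \<Rightarrow> ('a \<Rightarrow> nat) set" where
  "orderings E = {\<sigma>. bij_betw \<sigma> E {1..card E}}"

definition ordering_cost :: "'a set \<Rightarrow> ('a set \<Rightarrow> real) \<Rightarrow> ('a \<Rightarrow> nat) \<Rightarrow> real" where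
  "ordering_cost E f \<sigma> = (\<Sum>i = 1..card E. f (prefix_set E \<sigma> i))"

definition kappa :: "'a set \<Rightarrow> ('a set \<Rightarrow> real) \<Rightarrow> real" where
  "kappa E f = Max ((\<lambda>x. f {x}) ` E)"

definition ell :: "'a set \<Rightarrow> ('a set \<Rightarrow> real) \<Rightarrow> real" where
  "ell E f = f E / kappa E f"

text \<open>Orderings are total functions with arbitrary values outside \<open>E\<close>, so \<open>orderings E\<close>
  may be infinite; the set of costs is nevertheless finite and nonempty, so that its
  \<open>Min\<close> is the minimum over all bijections.\<close>

lemma finite_ordering_costs:
  assumes "finite E"
  shows "finite (ordering_cost E f ` orderings E)"
proof -
  let ?T = "{h. \<forall>i. (i \<in> {1..card E} \<longrightarrow> h i \<in> Pow E) \<and> (i \<notin> {1..card E} \<longrightarrow> h i = {})}"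
  have "finite ?T"
    by (rule finite_set_of_finite_funs) (use assms in simp_all)
  moreover have "ordering_cost E f ` orderings E \<subseteq> (\<lambda>h. \<Sum>i = 1..card E. f (h i)) ` ?T"
  proof
    fix c assume "c \<in> ordering_cost E f ` orderings E"
    then obtain \<sigma> where c: "c = ordering_cost E f \<sigma>" by blast
    define h where "h = (\<lambda>i. if i \<in> {1..card E} then prefix_set E \<sigma> i else {})"
    have "h \<in> ?T" by (auto simp: prefix_set_def h_def)
    moreover have "c = (\<Sum>i = 1..card E. f (h i))"
      unfolding c ordering_cost_def by (rule sum.cong) (auto simp: h_def)
    ultimately show "c \<in> (\<lambda>h. \<Sum>i = 1..card E. f (h i)) ` ?T" by (intro image_eqI)
  qed
  ultimately show ?thesis by (meson finite_imageI finite_subset)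
qed

lemma orderings_nonempty:
  assumes "finite E"
  shows "orderings E \<noteq> {}"
  using finite_same_card_bij[OF assms, of "{1..card E}"] by (auto simp: orderings_def)

end

theory Submission
  imports Defs
begin

text \<open>
  The points \<open>(|\<Pi>\<^sub>i|, f(\<Pi>\<^sub>i))\<close> are the vertices of the lower convex envelope of the points
  \<open>(|X|, f(X))\<close>, so summing the envelope over \<open>1, \<dots>, |E|\<close> gives a lower bound \<open>H\<close> on the cost of
  every ordering. On a block \<open>\<Pi>\<^sub>i \<subset> \<Pi>\<^sub>i\<^sub>+\<^sub>1\<close> with \<open>m\<close> new elements and increment \<open>d\<close> of \<open>f\<close>, the
  \<open>j\<close>-th new prefix of \<open>\<sigma>\<close> has value at most \<open>f(\<Pi>\<^sub>i) + min d (j \<kappa>)\<close>, and so the block exceeds the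
  envelope by at most \<open>d (\<kappa> m - d) / (2 \<kappa>)\<close>. Convexity of the envelope bounds the total excess by
  \<open>(|E| - \<ell>) / (|E| + 1) \<cdot> H\<close>, by induction on the number of blocks.
\<close>

section \<open>Sums over blocks and the inequality between excess and envelope\<close>

lemma sum_consecutive_blocks:
  fixes N :: "nat \<Rightarrow> nat" and g :: "nat \<Rightarrow> 'b::comm_monoid_add"
  assumes "\<And>i. i < s \<Longrightarrow> N i \<le> N (Suc i)" and "N 0 = 0"
  shows "(\<Sum>k = 1..N s. g k) = (\<Sum>i<s. \<Sum>j = 1..N (Suc i) - N i. g (N i + j))"
  using assms(1)
proof (induction s)
  case 0
  then show ?case using assms(2) by simp
next
  case (Suc s)
  have le: "N s \<le> N (Suc s)" using Suc.prems by simp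
  have "(\<Sum>k = 1..N (Suc s). g k) = (\<Sum>k = 1..N s. g k) + (\<Sum>k = Suc (N s)..N (Suc s). g k)"
    using le sum.ub_add_nat[of 1 "N s" g "N (Suc s) - N s"] by simp
  also have "(\<Sum>k = Suc (N s)..N (Suc s). g k) = (\<Sum>j = 1..N (Suc s) - N s. g (N s + j))"
    using le sum.shift_bounds_cl_nat_ivl[of g 1 "N s" "N (Suc s) - N s"] by (simp add: add.commute)
  finally show ?case using Suc by simp
qed

text \<open>For \<open>\<kappa> > 0\<close>, dividing by \<open>2 * \<kappa>\<close> gives a bound
  that is attained when \<open>d\<close> is a multiple of \<open>\<kappa>\<close>: the summands then
  grow linearly up to \<open>d\<close> and stay there. In between, the slack is the product of the
  distances of \<open>d\<close> to the neighbouring multiples.\<close>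

lemma sum_min_multiples_le:
  fixes d \<kappa> :: real
  assumes "0 \<le> d" and "0 \<le> \<kappa>" and "d \<le> \<kappa> * real m"
  shows "2 * \<kappa> * (\<Sum>j = 1..m. min d (real j * \<kappa>)) \<le> 2 * \<kappa> * real m * d - d * (d - \<kappa>)"
  using assms(3)
proof (induction m)
  case 0
  then show ?case using assms by simp
next
  case (Suc m)
  show ?case
  proof (cases "d \<le> \<kappa> * real m")
    case True
    have "2 * \<kappa> * min d (real (Suc m) * \<kappa>) \<le> 2 * \<kappa> * d"
      using assms by (intro mult_left_mono) auto
    with Suc.IH[OF True] show ?thesis by (simp add: algebra_simps)
  next
    case False
    have "2 * (\<Sum>j = 1..m. min d (real j * \<kappa>)) \<le> 2 * (\<Sum>j = 1..m. real j * \<kappa>)"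
      by (intro mult_left_mono sum_mono) auto
    also have "\<dots> = real m * (real m + 1) * \<kappa>"
      by (induction m) (auto simp: algebra_simps)
    finally have "2 * (\<Sum>j = 1..Suc m. min d (real j * \<kappa>)) \<le> real m * (real m + 1) * \<kappa> + 2 * d"
      by simp
    then have "\<kappa> * (2 * (\<Sum>j = 1..Suc m. min d (real j * \<kappa>)))
        \<le> \<kappa> * (real m * (real m + 1) * \<kappa> + 2 * d)"
      using assms by (intro mult_left_mono) auto
    \<comment> \<open>This product is exactly the right-hand side of the goal minus the bound just
      obtained.\<close>
    moreover have "0 \<le> (\<kappa> * real (Suc m) - d) * (d - \<kappa> * real m)"
      using False Suc.prems by (intro mult_nonneg_nonneg) auto
    ultimately show ?thesis by (simp add: algebra_simps)
  qed
qed

text \<open>The left sum is \<open>2 * \<kappa>\<close> times the bound on the total excess, and the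
  right sum is twice the summed envelope. For \<open>N i > 0\<close>, the premise
  \<open>convex\<close> says that the slope \<open>F i / N i\<close> averaged over the earlier
  blocks does not exceed that of block \<open>i\<close>. \<open>N\<close> and \<open>F\<close> are
  real-valued so that differences are not truncated.\<close>

lemma block_excess_le:
  fixes N F :: "nat \<Rightarrow> real" and \<kappa> :: real
  defines "m \<equiv> \<lambda>i. N (Suc i) - N i" and "d \<equiv> \<lambda>i. F (Suc i) - F i"
  assumes zero: "N 0 = 0" "F 0 = 0"
    and m: "\<And>i. i < s \<Longrightarrow> 0 \<le> m i" and d: "\<And>i. i < s \<Longrightarrow> 0 \<le> d i"
    and d_le: "\<And>i. i < s \<Longrightarrow> d i \<le> \<kappa> * m i"
    and convex: "\<And>i. i < s \<Longrightarrow> F i * m i \<le> N i * d i"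
  shows "(N s + 1) * (\<Sum>i<s. d i * (\<kappa> * m i - d i))
    \<le> (\<kappa> * N s - F s) * (\<Sum>i<s. 2 * F i * m i + d i * (m i + 1))"
proof -
  define Q where "Q = (\<lambda>s. \<Sum>i<s. d i * (\<kappa> * m i - d i))"
  define H where "H = (\<lambda>s. \<Sum>i<s. 2 * F i * m i + d i * (m i + 1))"
  \<comment> \<open>The bound \<open>Q s \<le> F s * (\<kappa> * N s - F s)\<close> strengthens the
    induction: a new block of size \<open>x\<close> raises the factor \<open>N s + 1\<close> by
    \<open>x\<close>, and the resulting extra term \<open>x * Q s\<close> has to be
    controlled.\<close>
  have "0 \<le> N s \<and> 0 \<le> F s \<and> F s \<le> \<kappa> * N s \<and> 0 \<le> H s \<and> Q s \<le> F s * (\<kappa> * N s - F s)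
    \<and> (N s + 1) * Q s \<le> (\<kappa> * N s - F s) * H s"
    using m d d_le convex
  proof (induction s)
    case 0
    then show ?case by (simp add: zero Q_def H_def)
  next
    case (Suc s)
    define n L x y where "n = N s" and "L = F s" and "x = m s" and "y = d s"
    have IH: "0 \<le> n" "0 \<le> L" "L \<le> \<kappa> * n" "0 \<le> H s" "Q s \<le> L * (\<kappa> * n - L)"
      "(n + 1) * Q s \<le> (\<kappa> * n - L) * H s"
      using Suc by (auto simp: n_def L_def)
    have xy: "0 \<le> x" "0 \<le> y" "y \<le> \<kappa> * x" "L * x \<le> n * y"
      using Suc.prems[of s] by (auto simp: n_def L_def x_def y_def)
    have step: "N (Suc s) = n + x" "F (Suc s) = L + y"
      "Q (Suc s) = Q s + y * (\<kappa> * x - y)" "H (Suc s) = H s + (2 * L * x + y * (x + 1))"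
      by (auto simp: n_def L_def x_def y_def m_def d_def Q_def H_def)
    have L_slack: "0 \<le> \<kappa> * n - L" and y_slack: "0 \<le> \<kappa> * x - y"
      using IH xy by auto
    have H': "0 \<le> 2 * L * x + y * (x + 1)"
      using IH xy by simp
    have "0 \<le> L * (\<kappa> * x - y) + y * (\<kappa> * n - L)"
      using IH xy L_slack y_slack by simp
    then have Q': "Q (Suc s) \<le> (L + y) * (\<kappa> * (n + x) - (L + y))"
      using IH(5) by (simp add: step algebra_simps)
    \<comment> \<open>The difference of the two sides of the claim is the sum of the slacks of this
      inequality, of \<open>IH(6)\<close> and of the three nonnegative products below. Convexity
      enters only through \<open>n * y - L * x\<close>.\<close>
    have "x * Q s \<le> x * (L * (\<kappa> * n - L))"
      using IH xy by (intro mult_left_mono) auto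
    moreover have "0 \<le> (n * y - L * x) * y"
      using xy by simp
    moreover have "0 \<le> (\<kappa> * n - L) * (x * L + y)" "0 \<le> (\<kappa> * x - y) * (H s + 2 * L * x)"
      using IH xy L_slack y_slack by simp_all
    ultimately have "(n + x + 1) * (Q s + y * (\<kappa> * x - y))
        \<le> (\<kappa> * (n + x) - (L + y)) * (H s + (2 * L * x + y * (x + 1)))"
      using IH(6) by (simp add: algebra_simps)
    with IH xy Q' H' show ?case by (simp add: step distrib_left)
  qed
  then show ?thesis by (simp add: Q_def H_def)
qed

section \<open>Minimizers at the critical values\<close>

text \<open>For fixed \<open>X\<close> and \<open>Y\<close> the inequality to be shown is non-strict
  and continuous in the parameter, so it survives the passage to the endpoint.\<close>

lemma minimizer_left_limit:
  assumes "a < b" and min: "\<And>l. a < l \<Longrightarrow> l < b \<Longrightarrow> minimizer E f l X"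
  shows "minimizer E f b X"
proof -
  have "X \<subseteq> E"
    using min[of "(a + b) / 2"] \<open>a < b\<close> by (auto simp: minimizer_def is_arg_min_def field_simps)
  moreover have "f X - b * real (card X) \<le> f Y - b * real (card Y)" if "Y \<subseteq> E" for Y
  proof (rule tendsto_le[of "at_left b"])
    show "((\<lambda>l. f X - l * real (card X)) \<longlongrightarrow> f X - b * real (card X)) (at_left b)"
      and "((\<lambda>l. f Y - l * real (card Y)) \<longlongrightarrow> f Y - b * real (card Y)) (at_left b)"
      by (intro tendsto_intros)+
    show "\<forall>\<^sub>F l in at_left b. f X - l * real (card X) \<le> f Y - l * real (card Y)"
      using eventually_at_left_real[OF \<open>a < b\<close>] by eventually_elim
        (use min that in \<open>auto simp: minimizer_def is_arg_min_linorder\<close>)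
  qed simp
  ultimately show ?thesis by (simp add: minimizer_def is_arg_min_linorder)
qed

lemma minimizer_right_limit:
  assumes "a < b" and min: "\<And>l. a < l \<Longrightarrow> l < b \<Longrightarrow> minimizer E f l X"
  shows "minimizer E f a X"
proof -
  have "X \<subseteq> E"
    using min[of "(a + b) / 2"] \<open>a < b\<close> by (auto simp: minimizer_def is_arg_min_def field_simps)
  moreover have "f X - a * real (card X) \<le> f Y - a * real (card Y)" if "Y \<subseteq> E" for Y
  proof (rule tendsto_le[of "at_right a"])
    show "((\<lambda>l. f X - l * real (card X)) \<longlongrightarrow> f X - a * real (card X)) (at_right a)"
      and "((\<lambda>l. f Y - l * real (card Y)) \<longlongrightarrow> f Y - a * real (card Y)) (at_right a)"
      by (intro tendsto_intros)+
    show "\<forall>\<^sub>F l in at_right a. f X - l * real (card X) \<le> f Y - l * real (card Y)"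
      using eventually_at_right_real[OF \<open>a < b\<close>] by eventually_elim
        (use min that in \<open>auto simp: minimizer_def is_arg_min_linorder\<close>)
  qed simp
  ultimately show ?thesis by (simp add: minimizer_def is_arg_min_linorder)
qed

text \<open>\<open>lam (Suc i)\<close> is the right end of the interval of \<open>P i\<close> and
  the left end of that of \<open>P (Suc i)\<close>. Two minimizers at one parameter span an edge of
  the envelope with that slope.\<close>

lemma principal_partition_minimizers:
  assumes "principal_partition E f s P lam" and "i < s"
  shows "minimizer E f (lam (Suc i)) (P i)" and "minimizer E f (lam (Suc i)) (P (Suc i))"
proof -
  have min: "minimizer E f l (P j)" if "j \<le> s" "lam j < l" "l < lam (Suc j)" for j l
    using assms(1) that
    by (auto simp: principal_partition_def unique_maximal_minimizer_def maximal_minimizer_def)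
  have lam: "lam j < lam (Suc j)" if "j \<le> s" for j
    using assms(1) that by (simp add: principal_partition_def)
  show "minimizer E f (lam (Suc i)) (P i)"
    by (rule minimizer_left_limit[of "lam i"]) (use min lam assms(2) in auto)
  show "minimizer E f (lam (Suc i)) (P (Suc i))"
    by (rule minimizer_right_limit[of _ "lam (Suc (Suc i))"]) (use min lam assms(2) in auto)
qed

section \<open>Prefixes of an ordering\<close>

lemma prefix_set_0:
  assumes "\<sigma> \<in> orderings E"
  shows "prefix_set E \<sigma> 0 = {}"
  using assms by (fastforce simp: orderings_def prefix_set_def dest: bij_betw_apply)

lemma card_prefix_set:
  assumes "\<sigma> \<in> orderings E" and "k \<le> card E"
  shows "card (prefix_set E \<sigma> k) = k"
proof -
  have bij: "bij_betw \<sigma> E {1..card E}"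
    using assms by (simp add: orderings_def)
  have "bij_betw \<sigma> (prefix_set E \<sigma> k) {1..k}"
  proof (rule bij_betw_subset[OF bij])
    show "\<sigma> ` prefix_set E \<sigma> k = {1..k}"
    proof
      show "\<sigma> ` prefix_set E \<sigma> k \<subseteq> {1..k}"
        using bij_betw_apply[OF bij] by (auto simp: prefix_set_def)
      show "{1..k} \<subseteq> \<sigma> ` prefix_set E \<sigma> k"
      proof
        fix i assume "i \<in> {1..k}"
        moreover from this have "i \<in> \<sigma> ` E"
          using assms(2) bij_betw_imp_surj_on[OF bij] by simp
        ultimately show "i \<in> \<sigma> ` prefix_set E \<sigma> k" by (auto simp: prefix_set_def)
      qed
    qed
  qed (auto simp: prefix_set_def)
  from bij_betw_same_card[OF this] show ?thesis by simp
qed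

lemma prefix_set_Suc:
  assumes "\<sigma> \<in> orderings E" and "k < card E"
  obtains x where "x \<in> E" and "prefix_set E \<sigma> (Suc k) = insert x (prefix_set E \<sigma> k)"
proof -
  have bij: "bij_betw \<sigma> E {1..card E}"
    using assms by (simp add: orderings_def)
  have "Suc k \<in> \<sigma> ` E"
    using assms(2) bij_betw_imp_surj_on[OF bij] by simp
  then obtain x where x: "Suc k = \<sigma> x" "x \<in> E"
    by (rule imageE)
  have "\<sigma> e = Suc k \<longleftrightarrow> e = x" if "e \<in> E" for e
    using inj_on_eq_iff[OF bij_betw_imp_inj_on[OF bij] that x(2)] by (simp add: x(1))
  then have "prefix_set E \<sigma> (Suc k) = insert x (prefix_set E \<sigma> k)"
    using x(2) by (intro set_eqI) (auto simp only: prefix_set_def le_Suc_eq mem_Collect_eq insert_iff)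
  with x(2) show ?thesis by (rule that)
qed

lemma singleton_le_kappa:
  assumes "finite E" and "x \<in> E"
  shows "f {x} \<le> kappa E f"
  using assms by (simp add: kappa_def)

text \<open>By submodularity each new element \<open>x\<close> adds at most \<open>f {x}\<close>,
  since nonnegativity allows the value of the intersection to be dropped.\<close>

lemma prefix_set_value_le:
  assumes "finite E" and nonneg: "\<forall>X\<subseteq>E. 0 \<le> f X" and sub: "submodular_on E f"
    and \<sigma>: "\<sigma> \<in> orderings E" and "k + j \<le> card E"
  shows "f (prefix_set E \<sigma> (k + j)) \<le> f (prefix_set E \<sigma> k) + real j * kappa E f"
  using assms(5)
proof (induction j)
  case 0
  then show ?case by simp
next
  case (Suc j)
  let ?A = "prefix_set E \<sigma> (k + j)"
  obtain x where x: "x \<in> E" "prefix_set E \<sigma> (k + Suc j) = insert x ?A"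
    using prefix_set_Suc[OF \<sigma>, of "k + j"] Suc.prems by auto
  have A: "?A \<subseteq> E" by (auto simp: prefix_set_def)
  then have "f (?A \<union> {x}) + f (?A \<inter> {x}) \<le> f ?A + f {x}"
    using sub x unfolding submodular_on_def by blast
  moreover have "0 \<le> f (?A \<inter> {x})"
    using nonneg A by blast
  moreover have "f {x} \<le> kappa E f"
    using singleton_le_kappa assms(1) x(1) .
  ultimately show ?case using Suc x by (simp add: algebra_simps)
qed

section \<open>The approximation bound\<close>

theorem theorem10:
  fixes E :: "'a set" and f :: "'a set \<Rightarrow> real" and s :: nat
    and P :: "nat \<Rightarrow> 'a set" and lam :: "nat \<Rightarrow> real" and \<sigma> :: "'a \<Rightarrow> nat"
  assumes "finite E"
    and "\<forall>X\<subseteq>E. 0 \<le> f X"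
    and "f E \<noteq> 0"
    and "mono_on (Pow E) f"
    and "submodular_on E f"
    and "f {} = 0"
    and "principal_partition E f s P lam"
    and "\<sigma> \<in> orderings E"
    and "\<forall>i\<in>{1..s}. prefix_set E \<sigma> (card (P i)) = P i"
  shows "ordering_cost E f \<sigma>
    \<le> (2 - (1 + ell E f) / (1 + real (card E))) * Min (ordering_cost E f ` orderings E)"
proof -
  define \<kappa> where "\<kappa> = kappa E f"
  define N where "N = (\<lambda>i. card (P i))"
  define F where "F = (\<lambda>i. f (P i))"
  define m where "m = (\<lambda>i. N (Suc i) - N i)"
  define d where "d = (\<lambda>i. F (Suc i) - F i)"
  \<comment> \<open>\<open>Q\<close> is \<open>2 * \<kappa>\<close> times the bound on the excess
    over the envelope, \<open>H\<close> is twice the envelope summed over all positive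
    cardinalities; the factors avoid fractions.\<close>
  define Q where "Q = (\<Sum>i<s. d i * (\<kappa> * real (m i) - d i))"
  define H where "H = (\<Sum>i<s. 2 * F i * real (m i) + d i * (real (m i) + 1))"
  have P: "P 0 = {}" "P s = E" "\<And>i. i < s \<Longrightarrow> P i \<subset> P (Suc i)"
    using assms(7) by (auto simp: principal_partition_def)
  have P_sub: "P i \<subseteq> E" if "i \<le> s" for i
    using that
  proof (induction rule: inc_induct)
    case base
    then show ?case by (simp add: P)
  next
    case (step i)
    then show ?case using P(3) by blast
  qed
  have N: "N 0 = 0" "N s = card E" and F: "F 0 = 0" "F s = f E"
    using P assms(6) by (auto simp: N_def F_def)
  have N_le: "N i \<le> N (Suc i)" "N (Suc i) \<le> card E" if "i < s" for i
    using P(3)[OF that] P_sub[of "Suc i"] that assms(1)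
    by (auto simp: N_def intro!: card_mono intro: finite_subset)
  have real_m: "real (m i) = real (N (Suc i)) - real (N i)" if "i < s" for i
    using N_le[OF that] by (simp add: m_def)
  \<comment> \<open>The hypothesis on \<open>\<sigma>\<close> starts at index 1; index 0 holds
    because positions start at 1.\<close>
  have prefix_N: "prefix_set E \<sigma> (N i) = P i" if "i \<le> s" for i
    using that assms(9) prefix_set_0[OF assms(8)] by (cases "i = 0") (auto simp: N_def P)
  have mono: "f X \<le> f Y" if "X \<subseteq> Y" "Y \<subseteq> E" for X Y
    using assms(4) that by (auto intro: mono_onD)
  have prefix_le: "f (prefix_set E \<sigma> (k + j)) \<le> f (prefix_set E \<sigma> k) + real j * \<kappa>"
    if "k + j \<le> card E" for k j
    unfolding \<kappa>_def using prefix_set_value_le assms(1,2,5,8) that by blast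
  have block_le: "f (prefix_set E \<sigma> (N i + j)) \<le> F i + min (d i) (real j * \<kappa>)"
    if "i < s" "j \<le> m i" for i j
  proof -
    have j: "N i + j \<le> N (Suc i)"
      using N_le[OF that(1)] that(2) by (simp add: m_def)
    have "prefix_set E \<sigma> (N i + j) \<subseteq> prefix_set E \<sigma> (N (Suc i))"
      using j by (auto simp: prefix_set_def)
    then have "f (prefix_set E \<sigma> (N i + j)) \<le> F (Suc i)"
      using mono prefix_N[of "Suc i"] P_sub[of "Suc i"] that by (simp add: F_def)
    moreover have "f (prefix_set E \<sigma> (N i + j)) \<le> F i + real j * \<kappa>"
      using prefix_le[of "N i" j] N_le[OF that(1)] j prefix_N[of i] that by (simp add: F_def)
    ultimately show ?thesis by (simp add: d_def)
  qed
  have d_nonneg: "0 \<le> d i" if "i < s" for i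
    using that mono P(3) P_sub by (simp add: d_def F_def psubset_imp_subset Suc_leI)
  \<comment> \<open>With \<open>j = m i\<close> the prefix in \<open>block_le\<close> is all of
    \<open>P (Suc i)\<close>, which forces the minimum to be \<open>d i\<close>.\<close>
  have d_le: "d i \<le> \<kappa> * real (m i)" if "i < s" for i
    using block_le[OF that order.refl] prefix_N[of "Suc i"] N_le[OF that] that
    by (simp add: m_def d_def F_def mult.commute)
  \<comment> \<open>The line of slope \<open>lam (Suc i)\<close> through the point of
    \<open>P i\<close> also meets that of \<open>P (Suc i)\<close> and lies below all others.
    Comparison with the empty set gives the middle conjunct, from which convexity follows.\<close>
  have envelope: "d i = lam (Suc i) * real (m i) \<and> F i \<le> lam (Suc i) * real (N i) \<and>
      (\<forall>X\<subseteq>E. F i + lam (Suc i) * (real (card X) - real (N i)) \<le> f X)" if "i < s" for i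
  proof -
    note min = principal_partition_minimizers[OF assms(7) that,
        unfolded minimizer_def is_arg_min_linorder]
    have le: "F i - lam (Suc i) * real (N i) \<le> f X - lam (Suc i) * real (card X)" if "X \<subseteq> E" for X
      using min(1) that by (simp add: F_def N_def)
    have "F (Suc i) - lam (Suc i) * real (N (Suc i)) \<le> F i - lam (Suc i) * real (N i)"
      using min by (simp add: F_def N_def)
    moreover have "F i - lam (Suc i) * real (N i) \<le> F (Suc i) - lam (Suc i) * real (N (Suc i))"
      using le[of "P (Suc i)"] min(2) by (simp add: F_def N_def)
    ultimately have "d i = lam (Suc i) * real (m i)"
      by (simp add: d_def real_m[OF that] algebra_simps)
    moreover have "F i \<le> lam (Suc i) * real (N i)"
      using le[of "{}"] assms(6) by simp
    ultimately show ?thesis using le by (simp add: algebra_simps)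
  qed
  have sum_id: "(\<Sum>j = 1..k. real j) = real k * (real k + 1) / 2" for k
    by (induction k) (auto simp: field_simps)
  have cost: "ordering_cost E f \<pi> = (\<Sum>i<s. \<Sum>j = 1..m i. f (prefix_set E \<pi> (N i + j)))" for \<pi>
    unfolding ordering_cost_def m_def N(2)[symmetric]
    by (rule sum_consecutive_blocks) (use N N_le in auto)
  \<comment> \<open>The prefix at position \<open>N i + j\<close> has exactly that many elements, so
    the supporting line of block \<open>i\<close> bounds it from below; each block then contributes
    an arithmetic progression.\<close>
  have lower: "H / 2 \<le> ordering_cost E f \<pi>" if \<pi>: "\<pi> \<in> orderings E" for \<pi>
  proof -
    have "(2 * F i * real (m i) + d i * (real (m i) + 1)) / 2
        \<le> (\<Sum>j = 1..m i. f (prefix_set E \<pi> (N i + j)))" if "i < s" for i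
    proof -
      have "(\<Sum>j = 1..m i. F i + lam (Suc i) * real j)
          \<le> (\<Sum>j = 1..m i. f (prefix_set E \<pi> (N i + j)))"
      proof (rule sum_mono)
        fix j assume "j \<in> {1..m i}"
        then have "card (prefix_set E \<pi> (N i + j)) = N i + j"
          using card_prefix_set[OF \<pi>, of "N i + j"] N_le[OF that] by (auto simp: m_def)
        moreover have "prefix_set E \<pi> (N i + j) \<subseteq> E" by (auto simp: prefix_set_def)
        ultimately show "F i + lam (Suc i) * real j \<le> f (prefix_set E \<pi> (N i + j))"
          using envelope[OF that] by force
      qed
      moreover have "(\<Sum>j = 1..m i. F i + lam (Suc i) * real j)
          = (2 * F i * real (m i) + d i * (real (m i) + 1)) / 2"
        unfolding sum.distrib sum_distrib_left[symmetric] sum_id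
        using envelope[OF that] by (simp add: algebra_simps)
      ultimately show ?thesis by simp
    qed
    then show ?thesis by (auto simp: H_def cost sum_divide_distrib intro!: sum_mono)
  qed
  have nontrivial: "0 < f E"
    using assms(2,3) by (metis order.refl order_le_less)
  have fE_le: "f E \<le> real (card E) * \<kappa>"
    using prefix_le[of 0 "card E"] prefix_N[of s] prefix_set_0[OF assms(8)] assms(6) N P
    by simp
  have \<kappa>: "0 < \<kappa>"
    using less_le_trans[OF nontrivial fE_le] by (auto simp: zero_less_mult_iff)
  have upper: "2 * \<kappa> * ordering_cost E f \<sigma> \<le> \<kappa> * H + Q"
  proof -
    have "2 * \<kappa> * (\<Sum>j = 1..m i. f (prefix_set E \<sigma> (N i + j)))
        \<le> \<kappa> * (2 * F i * real (m i) + d i * (real (m i) + 1)) + d i * (\<kappa> * real (m i) - d i)"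
      if "i < s" for i
    proof -
      have "(\<Sum>j = 1..m i. f (prefix_set E \<sigma> (N i + j)))
          \<le> (\<Sum>j = 1..m i. F i + min (d i) (real j * \<kappa>))"
        using block_le[OF that] by (intro sum_mono) auto
      also have "\<dots> = real (m i) * F i + (\<Sum>j = 1..m i. min (d i) (real j * \<kappa>))"
        by (simp add: sum.distrib)
      finally have "2 * \<kappa> * (\<Sum>j = 1..m i. f (prefix_set E \<sigma> (N i + j)))
          \<le> 2 * \<kappa> * (real (m i) * F i + (\<Sum>j = 1..m i. min (d i) (real j * \<kappa>)))"
        using \<kappa> by (intro mult_left_mono) auto
      then show ?thesis
        using sum_min_multiples_le[OF d_nonneg[OF that] less_imp_le[OF \<kappa>] d_le[OF that]]
        by (simp add: algebra_simps)
    qed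
    then have "(\<Sum>i<s. 2 * \<kappa> * (\<Sum>j = 1..m i. f (prefix_set E \<sigma> (N i + j))))
      \<le> (\<Sum>i<s. \<kappa> * (2 * F i * real (m i) + d i * (real (m i) + 1))
          + d i * (\<kappa> * real (m i) - d i))"
      by (intro sum_mono) auto
    then show ?thesis by (simp only: cost sum.distrib sum_distrib_left[symmetric] H_def Q_def)
  qed
  have "(real (N s) + 1) * (\<Sum>i<s. (F (Suc i) - F i)
          * (\<kappa> * (real (N (Suc i)) - real (N i)) - (F (Suc i) - F i)))
    \<le> (\<kappa> * real (N s) - F s) * (\<Sum>i<s. 2 * F i * (real (N (Suc i)) - real (N i))
          + (F (Suc i) - F i) * (real (N (Suc i)) - real (N i) + 1))"
  proof (rule block_excess_le)
    fix i assume i: "i < s"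
    have "F i * real (m i) \<le> lam (Suc i) * real (N i) * real (m i)"
      using envelope[OF i] by (intro mult_right_mono) auto
    also have "\<dots> = real (N i) * d i"
      using envelope[OF i] by simp
    finally show "F i * (real (N (Suc i)) - real (N i)) \<le> real (N i) * (F (Suc i) - F i)"
      by (simp add: real_m[OF i] d_def)
  qed (use N F N_le d_nonneg d_le real_m in \<open>simp_all add: d_def\<close>)
  then have excess: "(real (card E) + 1) * Q \<le> (\<kappa> * real (card E) - f E) * H"
    by (simp add: Q_def H_def d_def real_m N F)
  define c where "c = 2 - (1 + ell E f) / (1 + real (card E))"
  \<comment> \<open>The claimed ratio with denominators cleared, using
    \<open>\<kappa> * ell E f = f E\<close>.\<close>
  have c: "\<kappa> * (1 + real (card E)) * c = \<kappa> * (1 + 2 * real (card E)) - f E"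
  proof -
    have "(1 + real (card E)) * c = 2 * (1 + real (card E)) - (1 + ell E f)"
      by (simp add: c_def right_diff_distrib)
    then have "\<kappa> * (1 + real (card E)) * c = \<kappa> * (2 * (1 + real (card E)) - (1 + ell E f))"
      by (simp only: mult.assoc)
    also have "\<dots> = \<kappa> * (1 + 2 * real (card E)) - \<kappa> * ell E f"
      by (simp add: algebra_simps)
    also have "\<kappa> * ell E f = f E"
      using \<kappa> by (simp add: ell_def \<kappa>_def[symmetric])
    finally show ?thesis .
  qed
  have "\<kappa> * (1 + real (card E)) * (2 * ordering_cost E f \<sigma>)
      = (1 + real (card E)) * (2 * \<kappa> * ordering_cost E f \<sigma>)"
    by simp
  also have "\<dots> \<le> (1 + real (card E)) * (\<kappa> * H + Q)"
    using upper by (intro mult_left_mono) auto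
  also have "\<dots> \<le> (\<kappa> * (1 + 2 * real (card E)) - f E) * H"
    using excess by (simp add: algebra_simps)
  also have "\<dots> = \<kappa> * (1 + real (card E)) * (c * H)"
    using c by (simp add: mult.assoc)
  finally have "2 * ordering_cost E f \<sigma> \<le> c * H"
    using \<kappa> by (subst (asm) mult_le_cancel_left_pos) auto
  moreover have "c * (H / 2) \<le> c * Min (ordering_cost E f ` orderings E)"
  proof (rule mult_left_mono)
    show "H / 2 \<le> Min (ordering_cost E f ` orderings E)"
      by (rule Min.boundedI)
        (use lower finite_ordering_costs[OF assms(1)] orderings_nonempty[OF assms(1)] in auto)
    \<comment> \<open>Multiplying the lower bound by \<open>c\<close> requires
      \<open>0 \<le> c\<close>, which follows from
      \<open>f E \<le> real (card E) * \<kappa>\<close>.\<close>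
    have "real (card E) * \<kappa> \<le> (1 + 2 * real (card E)) * \<kappa>"
      using \<kappa> by (intro mult_right_mono) auto
    with fE_le have "0 \<le> \<kappa> * (1 + real (card E)) * c"
      unfolding c by (simp only: mult.commute[of \<kappa>] diff_ge_0_iff_ge)
    moreover have "0 < \<kappa> * (1 + real (card E))"
      using \<kappa> by (intro mult_pos_pos) auto
    ultimately show "0 \<le> c"
      by (simp only: zero_le_mult_iff) linarith
  qed
  ultimately show ?thesis unfolding c_def[symmetric] by linarith
qed

end
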